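(* Let $T>0$ and $c\in\mathbb{R}$. Let $g\colon[0,+\infty)\to[0,+\infty)$ be a continuously differentiable function such that $g(0)=0$, $g(s)>0$ for all $s>0$, $$\lim_{s\to0^{+}}\frac{g(s)}{s}=0\qquad\text{and}\qquad \lim_{s\to+\infty}g'(s)=0.$$ Let $a\colon\mathbb{R}\to\mathbb{R}$ be a measurable $T$-periodic function, integrable on $[0,T]$, with $\int_{0}^{T}a(t)\,dt<0$. Then there exists $\lambda_{*}>0$ such that for each $0<\lambda<\lambda_{*}$ the equation $$u''+cu'+\lambda a(t)g(u)=0$$ has no positive $T$-periodic solution.
   Context: Solutions are meant in the Carathéodory sense: $u$ is continuously differentiable with $u'$ locally absolutely continuous, and the equation holds for almost every $t$. A positive $T$-periodic solution is a solution $u\colon\mathbb{R}\to\mathbb{R}$ with $u(t+T)=u(t)>0$ for all $t\in\mathbb{R}$. *)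

theory Defs
  imports "HOL-Analysis.Analysis"
begin

text \<open>
  Absolute continuity of a real function, in the usual \<open>\<epsilon>\<close>-\<open>\<delta>\<close> form over finite families of
  non-overlapping compact intervals \<open>K = {Inf K..Sup K}\<close> contained in \<open>S\<close>.
\<close>

definition absolutely_continuous_on :: "real set \<Rightarrow> (real \<Rightarrow> real) \<Rightarrow> bool" where
  "absolutely_continuous_on S f \<longleftrightarrow>
     (\<forall>\<epsilon>>0. \<exists>\<delta>>0. \<forall>D. D division_of \<Union>D \<and> \<Union>D \<subseteq> S \<and> (\<Sum>K\<in>D. Sup K - Inf K) < \<delta> \<longrightarrow>
        (\<Sum>K\<in>D. \<bar>f (Sup K) - f (Inf K)\<bar>) < \<epsilon>)"

definition locally_absolutely_continuous :: "(real \<Rightarrow> real) \<Rightarrow> bool" where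
  "locally_absolutely_continuous f \<longleftrightarrow> (\<forall>x y. absolutely_continuous_on {x..y} f)"

text \<open>
  Solutions on \<open>\<real>\<close>, in the Caratheodory sense, of \<open>u'' + f(t, u, u') = 0\<close>.
  The value of \<^const>\<open>deriv\<close> carries no information at points of non-differentiability,
  so differentiability of \<open>u'\<close> at almost every point is stated explicitly.
\<close>

definition caratheodory_solution ::
    "(real \<Rightarrow> real \<Rightarrow> real \<Rightarrow> real) \<Rightarrow> (real \<Rightarrow> real) \<Rightarrow> bool" where
  "caratheodory_solution f u \<longleftrightarrow>
     u C1_differentiable_on UNIV \<and>
     locally_absolutely_continuous (deriv u) \<and>
     (AE t in lebesgue. deriv u field_differentiable at t \<and>
        deriv (deriv u) t + f t (u t) (deriv u t) = 0)"

definition positive_periodic_solution ::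
    "real \<Rightarrow> (real \<Rightarrow> real \<Rightarrow> real \<Rightarrow> real) \<Rightarrow> (real \<Rightarrow> real) \<Rightarrow> bool" where
  "positive_periodic_solution T f u \<longleftrightarrow>
     caratheodory_solution f u \<and> (\<forall>t. u (t + T) = u t \<and> u t > 0)"

text \<open>
  Continuous differentiability on \<open>[0, \<infinity>)\<close>, with the one-sided derivative at \<open>0\<close>.  The library's
  \<^const>\<open>C1_differentiable_on\<close> uses two-sided derivatives, and so would constrain the function
  to the left of \<open>0\<close>.
\<close>

definition C1_on_nonneg :: "(real \<Rightarrow> real) \<Rightarrow> bool" where
  "C1_on_nonneg g \<longleftrightarrow>
     (\<exists>g'. (\<forall>s\<ge>0. (g has_real_derivative g' s) (at s within {0..})) \<and> continuous_on {0..} g')"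

end

theory Submission
  imports Defs
begin

text \<open>
  Let \<open>u\<close> be a positive \<open>T\<close>-periodic solution and put \<open>z = u' / (\<lambda> g(u))\<close>.  This quotient satisfies the
  Riccati-type equation
  \<open>z' + c z = - a(t) - \<lambda> g'(u(t)) z\<^sup>2\<close>
  almost everywhere, and \<open>g'\<close> is bounded, say by \<open>B\<close>, because it is continuous on \<open>[0, \<infinity>)\<close> and vanishes
  at infinity.

  By Rolle's theorem \<open>z\<close> has a zero \<open>t\<^sub>0\<close> in \<open>[-T, 0]\<close>.  As long as \<open>\<bar>z\<bar> \<le> M\<close>, integration of
  \<open>(e\<^sup>c\<^sup>t z)'\<close> from \<open>t\<^sub>0\<close> gives
  \<open>\<bar>z\<bar> \<le> e\<^bsup>2\<bar>c\<bar>T\<^esup> (\<parallel>a\<parallel> + 2 T \<lambda> B M\<^sup>2)\<close>, with the \<open>L\<^sup>1\<close> norm of \<open>a\<close> taken over \<open>[-T, T]\<close>.  For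
  \<open>M = e\<^bsup>2\<bar>c\<bar>T\<^esup> \<parallel>a\<parallel> + 1\<close> and small \<open>\<lambda>\<close> the right-hand side is less than \<open>M\<close>, so a continuation
  argument yields \<open>\<bar>z\<bar> \<le> M\<close> on \<open>[0, T]\<close>, where \<open>M\<close> depends neither on \<open>u\<close> nor on \<open>\<lambda>\<close>
  (\<open>quotient_bound\<close>).  The substitution \<open>s = u(t)\<close> shows that \<open>z\<close> has mean zero over a period
  (\<open>integral_quotient_over_period\<close>), so that integrating the equation for \<open>z\<close> over \<open>[0, T]\<close> leaves
  \<open>- \<integral> a = \<lambda> \<integral> g'(u) z\<^sup>2 \<le> \<lambda> T B M\<^sup>2\<close>.  The left-hand side is a fixed positive number, hence this is
  impossible for small \<open>\<lambda>\<close>.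

  Since solutions are meant in the Caratheodory sense, the integrations rest on the fundamental theorem
  of calculus for absolutely continuous functions,
  \<open>fundamental_theorem_of_calculus_absolutely_continuous\<close>, which is proved with the
  Henstock-Kurzweil integral.
\<close>

section \<open>Absolutely continuous functions\<close>

lemma division_element_Icc:
  fixes D :: "real set set"
  assumes "D division_of S" "K \<in> D"
  shows "Inf K \<le> Sup K" "Inf K \<in> S" "Sup K \<in> S"
proof -
  obtain p q where K: "K = cbox p q" "K \<noteq> {}" "K \<subseteq> S"
    using division_ofD(2,3,4)[OF assms] by blast
  then show "Inf K \<le> Sup K" "Inf K \<in> S" "Sup K \<in> S"
    by auto
qed

lemma absolutely_continuous_onE:
  assumes "absolutely_continuous_on S f" "e > 0"
  obtains d where "d > 0"
    "\<And>D. \<lbrakk>D division_of \<Union>D; \<Union>D \<subseteq> S; (\<Sum>K\<in>D. Sup K - Inf K) < d\<rbrakk>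
        \<Longrightarrow> (\<Sum>K\<in>D. \<bar>f (Sup K) - f (Inf K)\<bar>) < e"
proof -
  obtain d where "d > 0" and
    d: "\<forall>D. D division_of \<Union>D \<and> \<Union>D \<subseteq> S \<and> (\<Sum>K\<in>D. Sup K - Inf K) < d
          \<longrightarrow> (\<Sum>K\<in>D. \<bar>f (Sup K) - f (Inf K)\<bar>) < e"
    using assms(1)[unfolded absolutely_continuous_on_def, THEN spec, THEN mp, OF assms(2)] by blast
  show thesis
    using that[OF \<open>d > 0\<close>] d[rule_format, OF conjI, OF _ conjI] by blast
qed

lemma absolutely_continuous_on_imp_continuous_on:
  assumes "absolutely_continuous_on {x..y} f"
  shows "continuous_on {x..y} f"
  unfolding continuous_on_iff
proof (intro ballI allI impI)
  fix t e :: real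
  assume t: "t \<in> {x..y}" and "e > 0"
  obtain d where "d > 0" and
    d: "\<And>D. \<lbrakk>D division_of \<Union>D; \<Union>D \<subseteq> {x..y}; (\<Sum>K\<in>D. Sup K - Inf K) < d\<rbrakk>
        \<Longrightarrow> (\<Sum>K\<in>D. \<bar>f (Sup K) - f (Inf K)\<bar>) < e"
    by (rule absolutely_continuous_onE[OF assms \<open>e > 0\<close>]) (rule that)
  have *: "\<bar>f q - f p\<bar> < e" if "p \<in> {x..y}" "q \<in> {x..y}" "p \<le> q" "q - p < d" for p q
  proof -
    have "{cbox p q} division_of \<Union>{cbox p q}"
      using that division_of_self[of p q] by simp
    moreover have "\<Union>{cbox p q} \<subseteq> {x..y}"
      using that by auto
    ultimately show ?thesis
      using d[of "{cbox p q}"] that by auto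
  qed
  show "\<exists>d>0. \<forall>s\<in>{x..y}. dist s t < d \<longrightarrow> dist (f s) (f t) < e"
  proof (intro exI conjI ballI impI)
    fix s assume s: "s \<in> {x..y}" "dist s t < d"
    then show "dist (f s) (f t) < e"
      using *[of s t] *[of t s] t by (cases "s \<le> t") (auto simp: dist_real_def)
  qed fact
qed

lemma lipschitz_imp_absolutely_continuous_on:
  assumes "L-lipschitz_on S f"
  shows "absolutely_continuous_on S f"
  unfolding absolutely_continuous_on_def
proof (intro allI impI)
  fix e :: real assume "e > 0"
  have L: "L \<ge> 0"
    using assms by (rule lipschitz_on_nonneg)
  show "\<exists>d>0. \<forall>D. D division_of \<Union>D \<and> \<Union>D \<subseteq> S \<and> (\<Sum>K\<in>D. Sup K - Inf K) < d \<longrightarrow>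
          (\<Sum>K\<in>D. \<bar>f (Sup K) - f (Inf K)\<bar>) < e"
  proof (intro exI conjI allI impI)
    show "e / (L + 1) > 0"
      using \<open>e > 0\<close> L by simp
    fix D :: "real set set"
    assume D: "D division_of \<Union>D \<and> \<Union>D \<subseteq> S \<and> (\<Sum>K\<in>D. Sup K - Inf K) < e / (L + 1)"
    have nn: "0 \<le> (\<Sum>K\<in>D. Sup K - Inf K)"
      using D division_element_Icc(1)[of D "\<Union>D"] by (intro sum_nonneg) simp
    have "(\<Sum>K\<in>D. \<bar>f (Sup K) - f (Inf K)\<bar>) \<le> (\<Sum>K\<in>D. L * (Sup K - Inf K))"
    proof (rule sum_mono)
      fix K assume "K \<in> D"
      then have "Inf K \<le> Sup K" "Inf K \<in> S" "Sup K \<in> S"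
        using D division_element_Icc[of D "\<Union>D" K] by blast+
      then show "\<bar>f (Sup K) - f (Inf K)\<bar> \<le> L * (Sup K - Inf K)"
        using lipschitz_onD[OF assms, of "Sup K" "Inf K"] by (simp add: dist_real_def)
    qed
    also have "\<dots> = L * (\<Sum>K\<in>D. Sup K - Inf K)"
      by (simp add: sum_distrib_left)
    also have "\<dots> \<le> (L + 1) * (\<Sum>K\<in>D. Sup K - Inf K)"
      using nn by (intro mult_right_mono) auto
    also have "\<dots> < e"
      using D L by (simp add: pos_less_divide_eq mult.commute)
    finally show "(\<Sum>K\<in>D. \<bar>f (Sup K) - f (Inf K)\<bar>) < e" .
  qed
qed

lemma absolutely_continuous_on_mult:
  assumes f: "absolutely_continuous_on {x..y} f" and g: "absolutely_continuous_on {x..y} g"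
  shows "absolutely_continuous_on {x..y} (\<lambda>t. f t * g t)"
  unfolding absolutely_continuous_on_def
proof (intro allI impI)
  fix e :: real assume "e > 0"
  have "bounded (f ` {x..y})" "bounded (g ` {x..y})"
    using f g by (auto intro!: compact_imp_bounded compact_continuous_image
        absolutely_continuous_on_imp_continuous_on)
  then obtain A B where "A > 0" "B > 0"
    and A: "\<And>t. t \<in> {x..y} \<Longrightarrow> \<bar>f t\<bar> \<le> A" and B: "\<And>t. t \<in> {x..y} \<Longrightarrow> \<bar>g t\<bar> \<le> B"
    unfolding bounded_pos by auto
  have eB: "e / (2 * B) > 0" and eA: "e / (2 * A) > 0"
    using \<open>e > 0\<close> \<open>A > 0\<close> \<open>B > 0\<close> by simp_all
  obtain d1 where "d1 > 0" and d1:
    "\<And>D. \<lbrakk>D division_of \<Union>D; \<Union>D \<subseteq> {x..y}; (\<Sum>K\<in>D. Sup K - Inf K) < d1\<rbrakk>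
        \<Longrightarrow> (\<Sum>K\<in>D. \<bar>f (Sup K) - f (Inf K)\<bar>) < e / (2 * B)"
    by (rule absolutely_continuous_onE[OF f eB]) (rule that)
  obtain d2 where "d2 > 0" and d2:
    "\<And>D. \<lbrakk>D division_of \<Union>D; \<Union>D \<subseteq> {x..y}; (\<Sum>K\<in>D. Sup K - Inf K) < d2\<rbrakk>
        \<Longrightarrow> (\<Sum>K\<in>D. \<bar>g (Sup K) - g (Inf K)\<bar>) < e / (2 * A)"
    by (rule absolutely_continuous_onE[OF g eA]) (rule that)
  show "\<exists>d>0. \<forall>D. D division_of \<Union>D \<and> \<Union>D \<subseteq> {x..y} \<and> (\<Sum>K\<in>D. Sup K - Inf K) < d \<longrightarrow>
          (\<Sum>K\<in>D. \<bar>f (Sup K) * g (Sup K) - f (Inf K) * g (Inf K)\<bar>) < e"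
  proof (intro exI conjI allI impI)
    show "min d1 d2 > 0"
      using \<open>d1 > 0\<close> \<open>d2 > 0\<close> by simp
    fix D :: "real set set"
    assume D: "D division_of \<Union>D \<and> \<Union>D \<subseteq> {x..y} \<and> (\<Sum>K\<in>D. Sup K - Inf K) < min d1 d2"
    have "(\<Sum>K\<in>D. \<bar>f (Sup K) * g (Sup K) - f (Inf K) * g (Inf K)\<bar>)
        \<le> (\<Sum>K\<in>D. B * \<bar>f (Sup K) - f (Inf K)\<bar> + A * \<bar>g (Sup K) - g (Inf K)\<bar>)"
    proof (rule sum_mono)
      fix K assume "K \<in> D"
      then have K: "Inf K \<in> {x..y}" "Sup K \<in> {x..y}"
        using D division_element_Icc[of D "\<Union>D" K] by blast+
      have "f (Sup K) * g (Sup K) - f (Inf K) * g (Inf K)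
          = g (Sup K) * (f (Sup K) - f (Inf K)) + f (Inf K) * (g (Sup K) - g (Inf K))"
        by (simp add: algebra_simps)
      also have "\<bar>\<dots>\<bar> \<le> \<bar>g (Sup K)\<bar> * \<bar>f (Sup K) - f (Inf K)\<bar> + \<bar>f (Inf K)\<bar> * \<bar>g (Sup K) - g (Inf K)\<bar>"
        by (metis abs_mult abs_triangle_ineq)
      also have "\<dots> \<le> B * \<bar>f (Sup K) - f (Inf K)\<bar> + A * \<bar>g (Sup K) - g (Inf K)\<bar>"
        using A[OF K(1)] B[OF K(2)] by (intro add_mono mult_right_mono) auto
      finally show "\<bar>f (Sup K) * g (Sup K) - f (Inf K) * g (Inf K)\<bar>
          \<le> B * \<bar>f (Sup K) - f (Inf K)\<bar> + A * \<bar>g (Sup K) - g (Inf K)\<bar>" .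
    qed
    also have "\<dots> = B * (\<Sum>K\<in>D. \<bar>f (Sup K) - f (Inf K)\<bar>) + A * (\<Sum>K\<in>D. \<bar>g (Sup K) - g (Inf K)\<bar>)"
      by (simp add: sum.distrib sum_distrib_left)
    also have "\<dots> < B * (e / (2 * B)) + A * (e / (2 * A))"
      using D d1[of D] d2[of D] \<open>A > 0\<close> \<open>B > 0\<close> by (intro add_strict_mono mult_strict_left_mono) auto
    also have "\<dots> = e"
      using \<open>A > 0\<close> \<open>B > 0\<close> by simp
    finally show "(\<Sum>K\<in>D. \<bar>f (Sup K) * g (Sup K) - f (Inf K) * g (Inf K)\<bar>) < e" .
  qed
qed

lemma continuous_derivative_imp_absolutely_continuous_on:
  assumes "\<And>t. t \<in> {x..y} \<Longrightarrow> (f has_real_derivative f' t) (at t within {x..y})"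
    and "continuous_on {x..y} f'"
  shows "absolutely_continuous_on {x..y} f"
proof -
  have "bounded (f' ` {x..y})"
    using assms(2) by (auto intro!: compact_imp_bounded compact_continuous_image)
  then obtain B where "B > 0" and B: "\<And>t. t \<in> {x..y} \<Longrightarrow> \<bar>f' t\<bar> \<le> B"
    unfolding bounded_pos by auto
  have "B-lipschitz_on {x..y} f"
  proof (rule lipschitz_onI)
    fix s t assume "s \<in> {x..y}" "t \<in> {x..y}"
    then show "dist (f s) (f t) \<le> B * dist s t"
      unfolding dist_norm using assms(1) B
      by (intro field_differentiable_bound[where S = "{x..y}"]) auto
  qed (use \<open>B > 0\<close> in simp)
  then show ?thesis
    by (rule lipschitz_imp_absolutely_continuous_on)
qed

text \<open>
  The increments of \<open>F\<close> near a null set \<open>N\<close> are small in total: the measure of an open \<open>U \<supseteq> N\<close>, which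
  can be made small, bounds the total length of every system of non-overlapping intervals inside \<open>U\<close>.
\<close>

lemma absolutely_continuous_on_tagged_sum_small:
  assumes F: "absolutely_continuous_on {x..y} F" and N: "negligible N" and "e > 0"
  obtains U where "open U" "N \<subseteq> U"
    "\<And>p. \<lbrakk>p tagged_partial_division_of {x..y}; \<And>t K. (t, K) \<in> p \<Longrightarrow> K \<subseteq> U\<rbrakk>
        \<Longrightarrow> (\<Sum>(t, K)\<in>p. \<bar>F (Sup K) - F (Inf K)\<bar>) < e"
proof -
  obtain d where "d > 0" and
    d: "\<And>D. \<lbrakk>D division_of \<Union>D; \<Union>D \<subseteq> {x..y}; (\<Sum>K\<in>D. Sup K - Inf K) < d\<rbrakk>
        \<Longrightarrow> (\<Sum>K\<in>D. \<bar>F (Sup K) - F (Inf K)\<bar>) < e"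
    by (rule absolutely_continuous_onE[OF F \<open>e > 0\<close>]) (rule that)
  obtain U where U: "open U" "N \<subseteq> U" "U - N \<in> lmeasurable" "emeasure lebesgue (U - N) < ennreal d"
    using sets_lebesgue_outer_open[of N d] N \<open>d > 0\<close> negligible_imp_sets by blast
  have Um: "U \<in> lmeasurable"
    by (metis Diff_partition N U(2,3) fmeasurable.Un negligible_imp_measurable)
  have "measure lebesgue U = measure lebesgue (U - N)"
    by (metis N U(1) measure_Diff_null_set negligible_iff_null_sets lborelD borel_open sets_completionI_sets)
  also have "\<dots> < d"
    using U(3,4) \<open>d > 0\<close> by (simp add: emeasure_eq_measure2 ennreal_less_iff)
  finally have Ud: "measure lebesgue U < d" .
  show thesis
  proof (rule that[OF U(1,2)])
    fix p assume p: "p tagged_partial_division_of {x..y}" and pU: "\<And>t K. (t, K) \<in> p \<Longrightarrow> K \<subseteq> U"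
    let ?D = "snd ` p"
    have D: "?D division_of \<Union>?D"
      using p by (rule partial_division_of_tagged_division)
    \<comment> \<open>Two tags can share an interval only if it is a single point, which then equals both tags.\<close>
    have "inj_on snd p"
    proof (rule inj_onI, clarsimp)
      fix s t K assume sK: "(s, K) \<in> p" and tK: "(t, K) \<in> p"
      show "s = t"
      proof (rule ccontr)
        assume "s \<noteq> t"
        then have "interior K = {}"
          using tagged_partial_division_ofD(5)[OF p sK tK] by auto
        moreover obtain q r where "K = cbox q r"
          using tagged_partial_division_ofD(4)[OF p sK] by blast
        ultimately show False
          using tagged_partial_division_ofD(2)[OF p] sK tK \<open>s \<noteq> t\<close> by force
      qed
    qed
    then have "(\<Sum>(t, K)\<in>p. \<bar>F (Sup K) - F (Inf K)\<bar>) = (\<Sum>K\<in>?D. \<bar>F (Sup K) - F (Inf K)\<bar>)"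
      by (simp add: sum.reindex case_prod_unfold)
    also have "\<dots> < e"
    proof (rule d)
      show "\<Union>?D \<subseteq> {x..y}"
        using tagged_partial_division_ofD(3)[OF p] by fastforce
      have "(\<Sum>K\<in>?D. Sup K - Inf K) = (\<Sum>K\<in>?D. measure lebesgue K)"
      proof (rule sum.cong)
        fix K assume K: "K \<in> ?D"
        then obtain q r where "K = cbox q r" "K \<noteq> {}"
          using division_ofD(3,4)[OF D] by blast
        then show "Sup K - Inf K = measure lebesgue K"
          by auto
      qed simp
      also have "\<dots> = measure lebesgue (\<Union>?D)"
        using content_division[OF D] by simp
      also have "\<dots> \<le> measure lebesgue U"
      proof (rule measure_mono_fmeasurable)
        show "\<Union>?D \<subseteq> U"
          using pU by fastforce
        show "\<Union>?D \<in> sets lebesgue"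
          using lmeasurable_division[OF D] by blast
      qed (fact Um)
      finally show "(\<Sum>K\<in>?D. Sup K - Inf K) < d"
        using Ud by simp
    qed (fact D)
    finally show "(\<Sum>(t, K)\<in>p. \<bar>F (Sup K) - F (Inf K)\<bar>) < e" .
  qed
qed

section \<open>The fundamental theorem of calculus for absolutely continuous functions\<close>

text \<open>
  Tags outside \<open>N\<close> are treated by the straddle estimate, as for everywhere differentiable functions.
  At tags in \<open>N\<close> the integrand may be taken to be \<open>0\<close>, and the increments of \<open>F\<close> over the corresponding
  intervals are small in total by absolute continuity.
\<close>

lemma fundamental_theorem_of_calculus_absolutely_continuous:
  fixes F f :: "real \<Rightarrow> real"
  assumes "x \<le> y" and F: "absolutely_continuous_on {x..y} F" and N: "negligible N"
    and deriv: "\<And>t. t \<in> {x..y} - N \<Longrightarrow> (F has_real_derivative f t) (at t within {x..y})"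
  shows "(f has_integral F y - F x) {x..y}"
proof -
  define h where "h t = (if t \<in> N then 0 else f t)" for t
  have "(h has_integral F y - F x) {x..y}"
    unfolding has_integral_real
  proof (intro allI impI)
    fix e :: real assume "e > 0"
    define e' where "e' = e / (y - x + 1)"
    have "e' > 0"
      using \<open>e > 0\<close> \<open>x \<le> y\<close> by (simp add: e'_def)
    have "\<forall>t. \<exists>d>0. t \<in> {x..y} - N \<longrightarrow>
        (\<forall>s\<in>{x..y}. norm (s - t) < d \<longrightarrow> norm (F s - F t - f t * (s - t)) \<le> e' * norm (s - t))"
      using deriv \<open>e' > 0\<close> unfolding has_field_derivative_def has_derivative_within_alt
      by metis
    then obtain d where d0: "\<And>t. d t > 0"
      and d: "\<And>t s. \<lbrakk>t \<in> {x..y} - N; s \<in> {x..y}; norm (s - t) < d t\<rbrakk>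
        \<Longrightarrow> norm (F s - F t - f t * (s - t)) \<le> e' * norm (s - t)"
      by metis
    obtain U where U: "open U" "N \<subseteq> U"
      and small: "\<And>p. \<lbrakk>p tagged_partial_division_of {x..y}; \<And>t K. (t, K) \<in> p \<Longrightarrow> K \<subseteq> U\<rbrakk>
        \<Longrightarrow> (\<Sum>(t, K)\<in>p. \<bar>F (Sup K) - F (Inf K)\<bar>) < e'"
      using absolutely_continuous_on_tagged_sum_small[OF F N \<open>e' > 0\<close>] by metis
    define \<gamma> where "\<gamma> t = (if t \<in> N then U else ball t (d t))" for t
    show "\<exists>\<gamma>. gauge \<gamma> \<and> (\<forall>p. p tagged_division_of {x..y} \<and> \<gamma> fine p \<longrightarrow>
        norm ((\<Sum>(t, K)\<in>p. measure lborel K *\<^sub>R h t) - (F y - F x)) < e)"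
    proof (intro exI conjI allI impI)
      show "gauge \<gamma>"
        using U d0 by (auto simp: gauge_def \<gamma>_def)
      fix p assume "p tagged_division_of {x..y} \<and> \<gamma> fine p"
      then have p: "p tagged_division_of {x..y}" and fine: "\<gamma> fine p"
        by auto
      note pD = tagged_division_ofD[OF p]
      have elem: "\<exists>q r. K = {q..r} \<and> q \<le> t \<and> t \<le> r \<and> x \<le> q \<and> r \<le> y" if "(t, K) \<in> p" for t K
        using pD(2-4)[OF that] by fastforce
      define q where "q = {z \<in> p. fst z \<in> N}"
      have qp: "q \<subseteq> p"
        by (auto simp: q_def)
      have null_part: "(\<Sum>(t, K)\<in>q. \<bar>F (Sup K) - F (Inf K)\<bar>) < e'"
      proof (rule small)
        show "q tagged_partial_division_of {x..y}"
          using tagged_partial_division_subset[OF _ qp] p by (simp add: tagged_division_of_def)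
        show "K \<subseteq> U" if "(t, K) \<in> q" for t K
          using fineD[OF fine, of t K] that by (simp add: q_def \<gamma>_def)
      qed
      have bound: "\<bar>measure lborel K *\<^sub>R h t - (F (Sup K) - F (Inf K))\<bar>
          \<le> e' * measure lborel K + (if t \<in> N then \<bar>F (Sup K) - F (Inf K)\<bar> else 0)"
        if tK: "(t, K) \<in> p" for t K
      proof -
        obtain v w where K: "K = {v..w}" "v \<le> t" "t \<le> w" "x \<le> v" "w \<le> y"
          using elem[OF tK] by blast
        show ?thesis
        proof (cases "t \<in> N")
          case True
          then show ?thesis
            using K \<open>e' > 0\<close> by (simp add: h_def abs_minus_commute)
        next
          case False
          have "K \<subseteq> ball t (d t)"
            using fineD[OF fine tK] False by (simp add: \<gamma>_def)
          moreover have "v \<in> K" "w \<in> K"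
            using K by auto
          ultimately have "v \<in> ball t (d t)" "w \<in> ball t (d t)"
            by blast+
          then have "norm (v - t) < d t" "norm (w - t) < d t"
            by (simp_all add: dist_real_def abs_minus_commute)
          moreover have "norm (v - t) = t - v" "norm (w - t) = w - t"
            using K by auto
          ultimately have "\<bar>F v - F t - f t * (v - t)\<bar> \<le> e' * (t - v)" "\<bar>F w - F t - f t * (w - t)\<bar> \<le> e' * (w - t)"
            using d[of t v] d[of t w] K False by simp_all
          moreover have "(w - v) * f t - (F w - F v)
              = (F v - F t - f t * (v - t)) - (F w - F t - f t * (w - t))"
            by (simp add: algebra_simps)
          moreover have "e' * (w - v) = e' * (t - v) + e' * (w - t)"
            by (simp add: algebra_simps)
          ultimately have "\<bar>(w - v) * f t - (F w - F v)\<bar> \<le> e' * (w - v)"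
            by linarith
          then show ?thesis
            using K False by (simp add: h_def)
        qed
      qed
      have "norm (\<Sum>(t, K)\<in>p. measure lborel K *\<^sub>R h t - (F (Sup K) - F (Inf K)))
          \<le> (\<Sum>(t, K)\<in>p. e' * measure lborel K + (if t \<in> N then \<bar>F (Sup K) - F (Inf K)\<bar> else 0))"
      proof (rule sum_norm_le, clarify)
        fix t K assume "(t, K) \<in> p"
        then show "norm (measure lborel K *\<^sub>R h t - (F (Sup K) - F (Inf K)))
            \<le> e' * measure lborel K + (if t \<in> N then \<bar>F (Sup K) - F (Inf K)\<bar> else 0)"
          using bound unfolding real_norm_def by blast
      qed
      also have "\<dots> = e' * (y - x) + (\<Sum>(t, K)\<in>q. \<bar>F (Sup K) - F (Inf K)\<bar>)"
      proof -
        have "(\<Sum>(t, K)\<in>p. e' * measure lborel K) = e' * (y - x)"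
          using additive_content_tagged_division[of p x y] p \<open>x \<le> y\<close>
          by (simp add: case_prod_unfold flip: sum_distrib_left)
        moreover have "(\<Sum>(t, K)\<in>p. if t \<in> N then \<bar>F (Sup K) - F (Inf K)\<bar> else 0)
            = (\<Sum>(t, K)\<in>q. \<bar>F (Sup K) - F (Inf K)\<bar>)"
          unfolding q_def case_prod_unfold using pD(1) by (simp add: sum.inter_filter)
        ultimately show ?thesis
          by (simp add: case_prod_unfold sum.distrib)
      qed
      also have "(\<Sum>(t, K)\<in>p. measure lborel K *\<^sub>R h t - (F (Sup K) - F (Inf K)))
          = (\<Sum>(t, K)\<in>p. measure lborel K *\<^sub>R h t) - (F y - F x)"
        using additive_tagged_division_1[OF \<open>x \<le> y\<close> p, of F]
        by (simp add: case_prod_unfold sum_subtractf)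
      also note add_strict_left_mono[OF null_part, of "e' * (y - x)"]
      also have "e' * (y - x) + e' = e' * (y - x + 1)"
        by (simp add: algebra_simps)
      also have "\<dots> = e"
        using \<open>x \<le> y\<close> by (simp add: e'_def)
      finally show "norm ((\<Sum>(t, K)\<in>p. measure lborel K *\<^sub>R h t) - (F y - F x)) < e" .
    qed
  qed
  then show ?thesis
    by (rule has_integral_spike[OF N, rotated]) (auto simp: h_def)
qed

section \<open>The equation for the quotient\<close>

text \<open>
  The integrated form of \<open>(e\<^sup>k\<^sup>t z)' = e\<^sup>k\<^sup>t ((k - c) z - a - \<lambda> g'(u) z\<^sup>2)\<close>, which combines the equation for
  \<open>z\<close> with a free exponential weight: \<open>k = c\<close> removes the linear term, and \<open>k = 0\<close> gives the equation
  itself.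
\<close>

lemma integral_identity_for_quotient:
  fixes a g g' u :: "real \<Rightarrow> real" and c k lam :: real
  defines "z \<equiv> \<lambda>t. deriv u t / (lam * g (u t))"
  assumes sol: "caratheodory_solution (\<lambda>t x y. c * y + lam * a t * g x) u"
    and u_pos: "\<And>t. u t > 0"
    and lam: "lam > 0"
    and g_deriv: "\<And>s. s > 0 \<Longrightarrow> (g has_real_derivative g' s) (at s)"
    and g'_cont: "continuous_on {0<..} g'"
    and g_pos: "\<And>s. s > 0 \<Longrightarrow> g s > 0"
    and "x \<le> y"
  shows "((\<lambda>t. exp (k * t) * ((k - c) * z t - a t - lam * g' (u t) * (z t)\<^sup>2)) has_integral
           exp (k * y) * z y - exp (k * x) * z x) {x..y}"
proof -
  obtain D where D: "\<And>t. (u has_vector_derivative D t) (at t)" "continuous_on UNIV D"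
    using sol unfolding caratheodory_solution_def C1_differentiable_on_def by blast
  have "deriv u = D"
    using D(1) by (intro ext DERIV_imp_deriv) (simp add: has_real_derivative_iff_has_vector_derivative)
  then have u': "\<And>t. (u has_real_derivative deriv u t) (at t)" and u'_cont: "continuous_on UNIV (deriv u)"
    using D by (simp_all add: has_real_derivative_iff_has_vector_derivative)
  obtain N where N: "negligible N" and eqn: "\<And>t. t \<notin> N \<Longrightarrow> deriv u field_differentiable at t
      \<and> deriv (deriv u) t + (c * deriv u t + lam * a t * g (u t)) = 0"
    using sol unfolding caratheodory_solution_def eventually_ae_filter_negligible by blast
  define \<phi> where "\<phi> t = exp (k * t) / (lam * g (u t))" for t
  define \<phi>' where "\<phi>' t = (k * exp (k * t) * (lam * g (u t)) - exp (k * t) * (lam * (g' (u t) * deriv u t)))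
      / (lam * g (u t))\<^sup>2" for t
  have nz: "lam * g (u t) \<noteq> 0" for t
    using lam g_pos[OF u_pos[of t]] by simp
  have gu: "((\<lambda>t. g (u t)) has_real_derivative g' (u t) * deriv u t) (at t)" for t
    by (rule DERIV_chain2[OF g_deriv[OF u_pos] u'])
  have \<phi>: "(\<phi> has_real_derivative \<phi>' t) (at t)" for t
    unfolding \<phi>_def[abs_def] \<phi>'_def using nz[of t]
    by (auto intro!: derivative_eq_intros gu simp: power2_eq_square)
  have u_cont: "continuous_on UNIV u"
    using u' by (intro DERIV_continuous_on) auto
  have gu_cont: "continuous_on UNIV (\<lambda>t. g (u t))"
    using gu by (intro DERIV_continuous_on) auto
  have g'u_cont: "continuous_on UNIV (\<lambda>t. g' (u t))"
    using u_pos by (intro continuous_on_compose2[OF g'_cont u_cont]) auto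
  have "continuous_on UNIV \<phi>'"
    unfolding \<phi>'_def using nz by (intro continuous_intros gu_cont g'u_cont u'_cont) auto
  then have "absolutely_continuous_on {x..y} \<phi>"
    using \<phi> by (intro continuous_derivative_imp_absolutely_continuous_on[where f' = \<phi>'])
      (auto intro: has_field_derivative_at_within continuous_on_subset)
  moreover have "absolutely_continuous_on {x..y} (deriv u)"
    using sol unfolding caratheodory_solution_def locally_absolutely_continuous_def by blast
  ultimately have "absolutely_continuous_on {x..y} (\<lambda>t. \<phi> t * deriv u t)"
    by (rule absolutely_continuous_on_mult)
  moreover have "((\<lambda>t. \<phi> t * deriv u t) has_real_derivative
      exp (k * t) * ((k - c) * z t - a t - lam * g' (u t) * (z t)\<^sup>2)) (at t within {x..y})"
    if "t \<in> {x..y} - N" for t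
  proof -
    have "(deriv u has_real_derivative deriv (deriv u) t) (at t)"
      using eqn that by (simp add: DERIV_deriv_iff_field_differentiable)
    then have "((\<lambda>t. \<phi> t * deriv u t) has_real_derivative
        \<phi>' t * deriv u t + deriv (deriv u) t * \<phi> t) (at t)"
      by (rule DERIV_mult[OF \<phi>])
    moreover have u'': "deriv (deriv u) t = - c * deriv u t - lam * a t * g (u t)"
      using eqn[of t] that by auto
    have "\<phi>' t * deriv u t + deriv (deriv u) t * \<phi> t
        = exp (k * t) * ((k - c) * z t - a t - lam * g' (u t) * (z t)\<^sup>2)"
      unfolding u'' using nz[of t] by (simp add: \<phi>_def \<phi>'_def z_def field_simps power2_eq_square)
    ultimately show ?thesis
      by (simp add: has_field_derivative_at_within)
  qed
  ultimately have "((\<lambda>t. exp (k * t) * ((k - c) * z t - a t - lam * g' (u t) * (z t)\<^sup>2)) has_integral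
      \<phi> y * deriv u y - \<phi> x * deriv u x) {x..y}"
    by (rule fundamental_theorem_of_calculus_absolutely_continuous[OF \<open>x \<le> y\<close> _ N])
  then show ?thesis
    by (simp add: \<phi>_def z_def)
qed

text \<open>The integrand is the derivative of \<open>G(u(t))\<close>, where \<open>G\<close> is a primitive of \<open>1/g\<close> on \<open>(0, \<infinity>)\<close>,
  and \<open>u\<close> takes the same value at both end points.\<close>

lemma integral_quotient_over_period:
  fixes u g :: "real \<Rightarrow> real"
  assumes "x \<le> y" "u x = u y"
    and u': "\<And>t. t \<in> {x..y} \<Longrightarrow> (u has_real_derivative u' t) (at t within {x..y})"
    and u_pos: "\<And>t. t \<in> {x..y} \<Longrightarrow> u t > 0"
    and g_cont: "continuous_on {0<..} g"
    and g_pos: "\<And>s. s > 0 \<Longrightarrow> g s > 0"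
  shows "((\<lambda>t. u' t / g (u t)) has_integral 0) {x..y}"
proof -
  have cont: "continuous_on {x..y} u"
    using u' by (rule DERIV_continuous_on)
  obtain p where p: "p \<in> {x..y}" "\<And>t. t \<in> {x..y} \<Longrightarrow> u p \<le> u t"
    using continuous_attains_inf[OF _ _ cont] \<open>x \<le> y\<close> by fastforce
  obtain q where q: "q \<in> {x..y}" "\<And>t. t \<in> {x..y} \<Longrightarrow> u t \<le> u q"
    using continuous_attains_sup[OF _ _ cont] \<open>x \<le> y\<close> by fastforce
  have pos: "s > 0" if "s \<in> {u p..u q}" for s
    using that u_pos[OF p(1)] by auto
  have "((\<lambda>t. u' t *\<^sub>R inverse (g (u t))) has_integral integral {u x..u y} (\<lambda>s. inverse (g s))) {x..y}"
  proof (rule has_integral_substitution[OF \<open>x \<le> y\<close> _ _ _ u'])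
    show "u ` {x..y} \<subseteq> {u p..u q}"
      using p q by auto
    show "continuous_on {u p..u q} (\<lambda>s. inverse (g s))"
    proof (intro continuous_on_inverse ballI)
      show "continuous_on {u p..u q} g"
        using pos by (intro continuous_on_subset[OF g_cont]) auto
      show "g s \<noteq> 0" if "s \<in> {u p..u q}" for s
        using g_pos[OF pos[OF that]] by simp
    qed
  qed (use \<open>u x = u y\<close> in auto)
  then show ?thesis
    using \<open>u x = u y\<close> by (simp add: divide_inverse)
qed

section \<open>The a priori bound\<close>

text \<open>
  If \<open>\<bar>z\<bar>\<close> does not exceed \<open>M\<close> at \<open>r\<close> and the bound \<open>M\<close> on \<open>[r, t]\<close> always improves to a
  strict one at \<open>t\<close>, then there is no first point at which \<open>\<bar>z\<bar> = M\<close>, so that \<open>\<bar>z\<bar>\<close> never exceeds \<open>M\<close>.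
\<close>

lemma continuation_bound:
  fixes z :: "real \<Rightarrow> real"
  assumes cont: "continuous_on {r..s} z" and "\<bar>z r\<bar> \<le> M"
    and step: "\<And>t. \<lbrakk>t \<in> {r..s}; \<And>\<tau>. \<tau> \<in> {r..t} \<Longrightarrow> \<bar>z \<tau>\<bar> \<le> M\<rbrakk> \<Longrightarrow> \<bar>z t\<bar> < M"
    and t: "t \<in> {r..s}"
  shows "\<bar>z t\<bar> \<le> M"
proof (rule ccontr)
  assume "\<not> \<bar>z t\<bar> \<le> M"
  have cont_abs: "continuous_on {r..s} (\<lambda>\<tau>. \<bar>z \<tau>\<bar>)"
    by (intro continuous_intros cont)
  have hit: "\<exists>\<sigma>\<in>{r..\<tau>}. \<bar>z \<sigma>\<bar> = M" if "\<tau> \<in> {r..s}" "\<bar>z \<tau>\<bar> > M" for \<tau>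
    using IVT'[of "\<lambda>\<tau>. \<bar>z \<tau>\<bar>" r M \<tau>] that \<open>\<bar>z r\<bar> \<le> M\<close> continuous_on_subset[OF cont_abs]
    by fastforce
  define S where "S = {\<tau> \<in> {r..s}. \<bar>z \<tau>\<bar> = M}"
  have "closed S"
    unfolding S_def by (intro continuous_closed_preimage_constant cont_abs) auto
  moreover have "S \<subseteq> {r..s}"
    by (auto simp: S_def)
  ultimately have "compact S"
    by (meson bounded_closed_interval bounded_subset compact_eq_bounded_closed)
  moreover have "S \<noteq> {}"
    using hit[OF t] t \<open>\<not> \<bar>z t\<bar> \<le> M\<close> unfolding S_def by fastforce
  ultimately obtain \<sigma> where \<sigma>: "\<sigma> \<in> S" "\<And>\<tau>. \<tau> \<in> S \<Longrightarrow> \<sigma> \<le> \<tau>"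
    using compact_attains_inf by metis
  have "\<bar>z \<tau>\<bar> \<le> M" if "\<tau> \<in> {r..\<sigma>}" for \<tau>
  proof (rule ccontr)
    assume "\<not> \<bar>z \<tau>\<bar> \<le> M"
    moreover have "\<tau> \<in> {r..s}"
      using that \<sigma>(1) by (auto simp: S_def)
    ultimately obtain \<rho> where \<rho>: "\<rho> \<in> {r..\<tau>}" "\<bar>z \<rho>\<bar> = M"
      using hit by force
    with \<open>\<tau> \<in> {r..s}\<close> have "\<sigma> \<le> \<rho>"
      by (intro \<sigma>(2)) (auto simp: S_def)
    with \<rho> that have "\<rho> = \<tau>"
      by auto
    with \<rho> \<open>\<not> \<bar>z \<tau>\<bar> \<le> M\<close> show False
      by simp
  qed
  then have "\<bar>z \<sigma>\<bar> < M"
    using \<sigma>(1) by (intro step) (auto simp: S_def)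
  with \<sigma>(1) show False
    by (simp add: S_def)
qed

lemma periodic_integrable_on_two_periods:
  fixes f :: "real \<Rightarrow> real"
  assumes "T > 0" "\<And>t. f (t + T) = f t" "f integrable_on {0..T}"
  shows "f integrable_on {-T..T}"
proof -
  have "f integrable_on {-T..0}"
    using integrable_shift_real_ivl[OF assms(3), of T] assms(2) by simp
  then show ?thesis
    using assms(1,3) by (intro Henstock_Kurzweil_Integration.integrable_combine[where a = "-T" and c = 0 and b = T]) auto
qed

text \<open>
  The zero \<open>t0\<close> is taken in \<open>[-T, 0]\<close> rather than in \<open>[0, T]\<close>, so that integrating forward from it
  already covers the whole of \<open>[0, T]\<close>.  The function \<open>h\<close> stands for \<open>g'(u(t))\<close>, and the assumed identity is
  \<open>integral_identity_for_quotient\<close> with \<open>k = c\<close>.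
\<close>

lemma quotient_bound:
  fixes z a h :: "real \<Rightarrow> real" and c T M lam B :: real
  assumes "T > 0" "B > 0" "lam > 0"
    and z_cont: "continuous_on UNIV z"
    and ident: "\<And>x y. x \<le> y \<Longrightarrow>
        ((\<lambda>t. exp (c * t) * (- a t - lam * h t * (z t)\<^sup>2)) has_integral
           exp (c * y) * z y - exp (c * x) * z x) {x..y}"
    and h: "\<And>t. \<bar>h t\<bar> \<le> B"
    and a_int: "(\<lambda>t. \<bar>a t\<bar>) integrable_on {-T..T}"
    and t0: "t0 \<in> {-T..0}" "z t0 = 0"
    and M: "M > 0" "exp (\<bar>c\<bar> * T) * exp (\<bar>c\<bar> * T) * (integral {-T..T} (\<lambda>t. \<bar>a t\<bar>) + 2 * T * (lam * B * M\<^sup>2)) < M"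
    and t: "t \<in> {t0..T}"
  shows "\<bar>z t\<bar> \<le> M"
proof (rule continuation_bound[OF _ _ _ t])
  show "continuous_on {t0..T} z"
    using z_cont continuous_on_subset by blast
  show "\<bar>z t0\<bar> \<le> M"
    using t0 M by simp
  define E where "E = exp (\<bar>c\<bar> * T)"
  have E: "exp (c * t) \<le> E" "exp (- (c * t)) \<le> E" if "t \<in> {-T..T}" for t
  proof -
    have "\<bar>c * t\<bar> \<le> \<bar>c\<bar> * T"
      using that by (auto simp: abs_mult intro!: mult_left_mono)
    then show "exp (c * t) \<le> E" "exp (- (c * t)) \<le> E"
      by (simp_all add: E_def)
  qed
  fix s assume s: "s \<in> {t0..T}" and zM: "\<And>\<tau>. \<tau> \<in> {t0..s} \<Longrightarrow> \<bar>z \<tau>\<bar> \<le> M"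
  define F where "F \<tau> = E * (\<bar>a \<tau>\<bar> + lam * B * M\<^sup>2)" for \<tau>
  have F_int: "F integrable_on {-T..T}"
    unfolding F_def[abs_def] using a_int by (intro integrable_on_mult_right integrable_add) auto
  have sub: "{t0..s} \<subseteq> {-T..T}"
    using s t0 by auto
  have "\<bar>exp (c * s) * z s\<bar> = \<bar>integral {t0..s} (\<lambda>\<tau>. exp (c * \<tau>) * (- a \<tau> - lam * h \<tau> * (z \<tau>)\<^sup>2))\<bar>"
    using ident[of t0 s] s t0 by (simp add: integral_unique)
  also have "\<dots> \<le> integral {t0..s} F"
    unfolding real_norm_def[symmetric]
  proof (rule integral_norm_bound_integral)
    show "(\<lambda>\<tau>. exp (c * \<tau>) * (- a \<tau> - lam * h \<tau> * (z \<tau>)\<^sup>2)) integrable_on {t0..s}"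
      using ident[of t0 s] s by auto
    show "F integrable_on {t0..s}"
      by (rule integrable_on_subinterval[OF F_int sub])
    fix \<tau> assume \<tau>: "\<tau> \<in> {t0..s}"
    have "(z \<tau>)\<^sup>2 \<le> M\<^sup>2"
      using zM[OF \<tau>] by (metis abs_ge_zero power2_abs power_mono)
    then have "\<bar>lam * h \<tau> * (z \<tau>)\<^sup>2\<bar> \<le> lam * B * M\<^sup>2"
      using \<open>lam > 0\<close> \<open>B > 0\<close> h[of \<tau>] unfolding abs_mult by (intro mult_mono) auto
    then have "\<bar>- a \<tau> - lam * h \<tau> * (z \<tau>)\<^sup>2\<bar> \<le> \<bar>a \<tau>\<bar> + lam * B * M\<^sup>2"
      by linarith
    then show "norm (exp (c * \<tau>) * (- a \<tau> - lam * h \<tau> * (z \<tau>)\<^sup>2)) \<le> F \<tau>"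
      unfolding F_def real_norm_def abs_mult using E(1)[of \<tau>] \<tau> sub
      by (intro mult_mono) (auto simp: E_def)
  qed
  also have "\<dots> \<le> integral {-T..T} F"
  proof (rule integral_subset_le[OF sub _ F_int])
    show "F integrable_on {t0..s}"
      by (rule integrable_on_subinterval[OF F_int sub])
    show "\<forall>\<tau>\<in>{-T..T}. 0 \<le> F \<tau>"
      using \<open>lam > 0\<close> \<open>B > 0\<close> by (auto simp: F_def E_def)
  qed
  also have "\<dots> = E * (integral {-T..T} (\<lambda>t. \<bar>a t\<bar>) + 2 * T * (lam * B * M\<^sup>2))"
    using integral_add[OF a_int integrable_const_ivl[of "lam * B * M\<^sup>2" "-T" T]] \<open>T > 0\<close>
    by (simp add: F_def[abs_def])
  finally have w: "\<bar>exp (c * s) * z s\<bar> \<le> E * (integral {-T..T} (\<lambda>t. \<bar>a t\<bar>) + 2 * T * (lam * B * M\<^sup>2))" .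
  have "\<bar>z s\<bar> = exp (- (c * s)) * \<bar>exp (c * s) * z s\<bar>"
    by (simp add: abs_mult exp_minus)
  also have "\<dots> \<le> E * (E * (integral {-T..T} (\<lambda>t. \<bar>a t\<bar>) + 2 * T * (lam * B * M\<^sup>2)))"
    using w E(2)[of s] s t0 by (intro mult_mono) (auto simp: E_def)
  also have "\<dots> < M"
    using M(2) by (simp add: E_def mult.assoc)
  finally show "\<bar>z s\<bar> < M" .
qed

section \<open>Nonexistence of positive periodic solutions\<close>

text \<open>The bound on \<open>g'\<close> combines compactness of \<open>[0, s0]\<close> with the limit at infinity beyond \<open>s0\<close>.\<close>

lemma C1_on_nonneg_bounded_derivative:
  assumes "C1_on_nonneg g" "(deriv g \<longlongrightarrow> 0) at_top"
  obtains g' B where "\<And>s. s > 0 \<Longrightarrow> (g has_real_derivative g' s) (at s)" "continuous_on {0<..} g'"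
    "B > 0" "\<And>s. s > 0 \<Longrightarrow> \<bar>g' s\<bar> \<le> B"
proof -
  obtain g' where g': "\<And>s. s \<ge> 0 \<Longrightarrow> (g has_real_derivative g' s) (at s within {0..})"
    and cont: "continuous_on {0..} g'"
    using assms(1) unfolding C1_on_nonneg_def by auto
  have at: "(g has_real_derivative g' s) (at s)" if "s > 0" for s
    using g'[of s] at_within_interior[of s "{0..}"] that by (simp add: interior_real_atLeast)
  have "eventually (\<lambda>s. \<bar>deriv g s\<bar> < 1) at_top"
    using assms(2) by (simp add: tendsto_iff dist_real_def)
  then obtain s0 where s0: "\<And>s. s \<ge> s0 \<Longrightarrow> \<bar>deriv g s\<bar> < 1"
    unfolding eventually_at_top_linorder by auto
  have "compact (g' ` {0..s0})"
    by (intro compact_continuous_image continuous_on_subset[OF cont]) auto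
  then obtain b where b: "\<forall>s\<in>{0..s0}. \<bar>g' s\<bar> \<le> b"
    using compact_imp_bounded[of "g' ` {0..s0}"] unfolding bounded_iff by auto
  show thesis
  proof (rule that[of g' "max 1 b"])
    fix s :: real assume "s > 0"
    show "\<bar>g' s\<bar> \<le> max 1 b"
    proof (cases "s \<le> s0")
      case True
      then show ?thesis
        using bspec[OF b, of s] \<open>s > 0\<close> by simp
    next
      case False
      then show ?thesis
        using s0[of s] DERIV_imp_deriv[OF at[OF \<open>s > 0\<close>]] by simp
    qed
    next
    show "continuous_on {0<..} g'"
      using cont by (rule continuous_on_subset) auto
  qed (use at in auto)
qed

theorem theorem4p4:
  fixes T c :: real and g a :: "real \<Rightarrow> real"
  assumes T_pos: "T > 0"
    and g_C1: "C1_on_nonneg g"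
    and g_nonneg: "\<And>s. s \<ge> 0 \<Longrightarrow> g s \<ge> 0"
    and g_zero: "g 0 = 0"
    and g_pos: "\<And>s. s > 0 \<Longrightarrow> g s > 0"
    and g_lim_zero: "((\<lambda>s. g s / s) \<longlongrightarrow> 0) (at_right 0)"
    and g'_lim_infinity: "(deriv g \<longlongrightarrow> 0) at_top"
    and a_measurable: "a \<in> borel_measurable lebesgue"
    and a_periodic: "\<And>t. a (t + T) = a t"
    and a_integrable: "set_integrable lebesgue {0..T} a"
    and a_mean: "(LINT t:{0..T}|lebesgue. a t) < 0"
  shows "\<exists>lam_star>0. \<forall>lam. 0 < lam \<and> lam < lam_star \<longrightarrow>
    \<not> (\<exists>u. positive_periodic_solution T (\<lambda>t x y. c * y + lam * a t * g x) u)"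
proof -
  obtain g' B where g': "\<And>s. s > 0 \<Longrightarrow> (g has_real_derivative g' s) (at s)"
    and g'_cont: "continuous_on {0<..} g'" and "B > 0" and B: "\<And>s. s > 0 \<Longrightarrow> \<bar>g' s\<bar> \<le> B"
    using C1_on_nonneg_bounded_derivative[OF g_C1 g'_lim_infinity] by blast
  have g_cont: "continuous_on {0<..} g"
    using g' by (intro DERIV_continuous_on) (auto intro: has_field_derivative_at_within)
  have a_int: "a integrable_on {0..T}" and a_neg: "integral {0..T} a < 0"
    using set_lebesgue_integral_eq_integral[OF a_integrable] a_mean by simp_all
  have "(\<lambda>t. \<bar>a t\<bar>) integrable_on {0..T}"
    by (rule set_lebesgue_integral_eq_integral(1)[OF set_integrable_abs[OF a_integrable]])
  then have abs_a_int: "(\<lambda>t. \<bar>a t\<bar>) integrable_on {-T..T}"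
    using T_pos a_periodic by (intro periodic_integrable_on_two_periods) simp_all
  define A where "A = integral {-T..T} (\<lambda>t. \<bar>a t\<bar>)"
  have "A \<ge> 0"
    unfolding A_def using abs_a_int by (intro integral_nonneg) auto
  define E where "E = exp (\<bar>c\<bar> * T)"
  have "E > 0"
    by (simp add: E_def)
  define M where "M = E * E * A + 1"
  have "M > 0"
    using \<open>A \<ge> 0\<close> \<open>E > 0\<close> by (simp add: M_def add_nonneg_pos)
  \<comment> \<open>The first bound makes \<open>quotient_bound\<close> applicable with \<open>M\<close>, the second contradicts the mean of \<open>a\<close>.\<close>
  define lam_star where
    "lam_star = min (1 / (E * E * (2 * T * B * M\<^sup>2))) (- integral {0..T} a / (T * B * M\<^sup>2))"
  show ?thesis
  proof (intro exI conjI allI impI notI)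
    show "lam_star > 0"
      using a_neg T_pos \<open>B > 0\<close> \<open>E > 0\<close> \<open>M > 0\<close> by (simp add: lam_star_def divide_neg_pos)
    fix lam
    assume "0 < lam \<and> lam < lam_star"
    then have "lam > 0" and lam1: "lam * (E * E * (2 * T * B * M\<^sup>2)) < 1"
      and lam2: "lam * (T * B * M\<^sup>2) < - integral {0..T} a"
      using pos_less_divide_eq[of "E * E * (2 * T * B * M\<^sup>2)" lam 1]
        pos_less_divide_eq[of "T * B * M\<^sup>2" lam "- integral {0..T} a"]
        T_pos \<open>B > 0\<close> \<open>E > 0\<close> \<open>M > 0\<close> unfolding lam_star_def min_less_iff_conj by auto
    assume "\<exists>u. positive_periodic_solution T (\<lambda>t x y. c * y + lam * a t * g x) u"
    then obtain u where u: "positive_periodic_solution T (\<lambda>t x y. c * y + lam * a t * g x) u"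
      by (elim exE)
    then have sol: "caratheodory_solution (\<lambda>t x y. c * y + lam * a t * g x) u"
      and u_per: "\<And>t. u (t + T) = u t" and u_pos: "\<And>t. u t > 0"
      by (simp_all add: positive_periodic_solution_def)
    have u_C1: "\<And>t. u differentiable at t" "continuous_on UNIV (deriv u)"
      using sol unfolding caratheodory_solution_def C1_differentiable_on_eq
      by (auto simp: field_derivative_eq_vector_derivative)
    then have u': "(u has_real_derivative deriv u t) (at t)" for t
      by (simp add: DERIV_deriv_iff_real_differentiable)
    have u'_per: "deriv u T = deriv u 0"
    proof -
      have "((\<lambda>t. u (t + T)) has_real_derivative deriv u (0 + T)) (at 0)"
        by (rule DERIV_shift[THEN iffD1, OF u'])
      then show ?thesis
        using u_per DERIV_imp_deriv[of u] by simp
    qed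
    define z where "z t = deriv u t / (lam * g (u t))" for t
    have ident: "((\<lambda>t. exp (k * t) * ((k - c) * z t - a t - lam * g' (u t) * (z t)\<^sup>2)) has_integral
        exp (k * y) * z y - exp (k * x) * z x) {x..y}" if "x \<le> y" for k x y
      unfolding z_def
      by (rule integral_identity_for_quotient[OF sol u_pos \<open>lam > 0\<close> g' g'_cont g_pos that])
    have "continuous_on UNIV u"
      using u' by (intro DERIV_continuous_on) auto
    then have "continuous_on UNIV (\<lambda>t. g (u t))"
      using u_pos by (intro continuous_on_compose2[OF g_cont]) auto
    then have z_cont: "continuous_on UNIV z"
      unfolding z_def[abs_def] using u_C1(2) g_pos u_pos \<open>lam > 0\<close>
      by (intro continuous_intros) (auto simp: less_imp_neq[THEN not_sym])
    obtain t0 where t0: "-T < t0" "t0 < 0" "(u has_real_derivative 0) (at t0)"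
      using Rolle[of "-T" 0 u] T_pos u_per[of "-T"] u_C1(1) \<open>continuous_on UNIV u\<close> continuous_on_subset
      by fastforce
    have "z t0 = 0"
      using DERIV_imp_deriv[OF t0(3)] by (simp add: z_def)
    have z_bound: "\<bar>z t\<bar> \<le> M" if "t \<in> {0..T}" for t
    proof (rule quotient_bound[where T = T and B = B and lam = lam and h = "\<lambda>t. g' (u t)" and ?t0.0 = t0
            and c = c and a = a and z = z])
      show "((\<lambda>t. exp (c * t) * (- a t - lam * g' (u t) * (z t)\<^sup>2)) has_integral
          exp (c * y) * z y - exp (c * x) * z x) {x..y}" if "x \<le> y" for x y
        using ident[OF that, of c] by simp
      have "E * E * (A + 2 * T * (lam * B * M\<^sup>2)) = E * E * A + lam * (E * E * (2 * T * B * M\<^sup>2))"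
        by (simp add: algebra_simps)
      also have "\<dots> < M"
        using lam1 by (simp add: M_def)
      finally show "exp (\<bar>c\<bar> * T) * exp (\<bar>c\<bar> * T) * (integral {-T..T} (\<lambda>t. \<bar>a t\<bar>) + 2 * T * (lam * B * M\<^sup>2)) < M"
        by (simp add: A_def E_def)
    qed (use T_pos \<open>B > 0\<close> \<open>lam > 0\<close> z_cont B u_pos abs_a_int t0 \<open>z t0 = 0\<close> \<open>M > 0\<close> that in auto)
    have "((\<lambda>t. deriv u t / g (u t)) has_integral 0) {0..T}"
      using T_pos u' u_pos g_cont g_pos u_per[of 0]
      by (intro integral_quotient_over_period) (auto intro: has_field_derivative_at_within)
    then have "((\<lambda>t. c / lam * (deriv u t / g (u t))) has_integral c / lam * 0) {0..T}"
      by (rule has_integral_mult_right)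
    then have z_mean: "((\<lambda>t. c * z t) has_integral 0) {0..T}"
      by (simp add: z_def)
    have "z T = z 0"
      using u'_per u_per[of 0] by (simp add: z_def)
    then have "((\<lambda>t. - c * z t - a t - lam * g' (u t) * (z t)\<^sup>2) has_integral 0) {0..T}"
      using ident[of 0 T 0] T_pos by simp
    from has_integral_add[OF has_integral_add[OF this z_mean] integrable_integral[OF a_int]]
    have int_a: "((\<lambda>t. - (lam * g' (u t) * (z t)\<^sup>2)) has_integral integral {0..T} a) {0..T}"
      by (simp add: algebra_simps)
    have "norm (integral {0..T} a) \<le> lam * B * M\<^sup>2 * measure lborel {0..T}"
    proof (rule has_integral_bound_real[where S = "{}", OF _ _ int_a])
      fix t assume "t \<in> {0..T} - {}"
      then have "(z t)\<^sup>2 \<le> M\<^sup>2"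
        using z_bound[of t] by (metis Diff_empty abs_ge_zero power2_abs power_mono)
      then show "norm (- (lam * g' (u t) * (z t)\<^sup>2)) \<le> lam * B * M\<^sup>2"
        using \<open>lam > 0\<close> \<open>B > 0\<close> B[OF u_pos[of t]] unfolding real_norm_def abs_minus_cancel abs_mult
        by (intro mult_mono) auto
    qed (use \<open>lam > 0\<close> \<open>B > 0\<close> in auto)
    then show False
      using lam2 T_pos a_neg by (simp add: algebra_simps)
  qed
qed

end
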